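(* Let $\{B_n\}$ and $\{C_n\}$ denote the balancing and Lucas-balancing sequences, respectively. Then for every integer $n\geq 2$, $$\left\lfloor\left(\sum_{k=n}^{\infty}\frac{1}{B_k^3}\right)^{-1}\right\rfloor = B_n^3-B_{n-1}^3-\left\lceil\frac{3(2B_{n-1}+C_{n-1})}{164}\right\rceil.$$
   Context: The balancing sequence $\{B_n\}_{n\ge 0}$ is defined by $B_0=0$, $B_1=1$, and $B_n=6B_{n-1}-B_{n-2}$ for $n\ge 2$. The Lucas-balancing sequence $\{C_n\}_{n\ge 0}$ is given by $C_n=\sqrt{8B_n^2+1}$ (positive square root); equivalently $C_0=1$, $C_1=3$, and $C_n=6C_{n-1}-C_{n-2}$ for $n\ge 2$. Here $\lfloor\cdot\rfloor$ and $\lceil\cdot\rceil$ denote floor and ceiling. *)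

theory Defs
  imports Complex_Main
begin

fun balancing :: "nat \<Rightarrow> int" where
  "balancing 0 = 0"
| "balancing (Suc 0) = 1"
| "balancing (Suc (Suc n)) = 6 * balancing (Suc n) - balancing n"

definition lucas_balancing :: "nat \<Rightarrow> real" where
  "lucas_balancing n = sqrt (8 * real_of_int (balancing n) ^ 2 + 1)"

lemma balancing_growth: "0 \<le> balancing n \<and> 5 * balancing n \<le> balancing (Suc n)"
  by (induction n) auto

lemma balancing_Cassini:
  "balancing (Suc n) ^ 2 - 6 * balancing (Suc n) * balancing n + balancing n ^ 2 = 1"
proof (induction n)
  case (Suc n)
  then show ?case by (simp add: power2_eq_square algebra_simps)
qed simp

lemma lucas_balancing_eq:
  "lucas_balancing n = real_of_int (balancing (Suc n) - 3 * balancing n)"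
proof -
  have "8 * balancing n ^ 2 + 1 = (balancing (Suc n) - 3 * balancing n) ^ 2"
    using balancing_Cassini[of n] by (simp add: power2_eq_square algebra_simps)
  then have "real_of_int (8 * balancing n ^ 2 + 1)
      = real_of_int ((balancing (Suc n) - 3 * balancing n) ^ 2)"
    by (rule arg_cong)
  then have "8 * real_of_int (balancing n) ^ 2 + 1
      = real_of_int (balancing (Suc n) - 3 * balancing n) ^ 2"
    by (simp only: of_int_1 of_int_add of_int_mult of_int_numeral of_int_power)
  moreover have "0 \<le> balancing (Suc n) - 3 * balancing n"
    using balancing_growth[of n] by linarith
  ultimately show ?thesis
    unfolding lucas_balancing_def by (simp only: real_sqrt_abs abs_of_nonneg of_int_0_le_iff)
qed

lemma lucas_balancing_rec:
  "lucas_balancing 0 = 1"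
  "lucas_balancing (Suc 0) = 3"
  "lucas_balancing (Suc (Suc n)) = 6 * lucas_balancing (Suc n) - lucas_balancing n"
  by (simp_all add: lucas_balancing_eq)

lemma balancing_ge_power: "5 ^ n \<le> balancing (Suc n)"
proof (induction n)
  case (Suc n)
  then show ?case using balancing_growth[of "Suc n"] by simp
qed simp

lemma summable_inverse_balancing_cube:
  "summable (\<lambda>k. 1 / real_of_int (balancing (n + k)) ^ 3)"
proof -
  let ?f = "\<lambda>k. 1 / real_of_int (balancing k) ^ 3"
  have "norm (?f (k + 1)) \<le> (1 / 5) ^ k" for k
  proof -
    have "real_of_int (5 ^ k) \<le> real_of_int (balancing (Suc k))"
      by (simp only: of_int_le_iff balancing_ge_power)
    then have b: "(5::real) ^ k \<le> real_of_int (balancing (Suc k))"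
      by (simp only: of_int_power of_int_numeral)
    have one: "(1::real) \<le> real_of_int (balancing (Suc k))"
      using b one_le_power[of "5::real" k] by linarith
    then have "real_of_int (balancing (Suc k)) \<le> real_of_int (balancing (Suc k)) ^ 3"
      by (rule self_le_power) (rule zero_less_numeral)
    with b have "(5::real) ^ k \<le> real_of_int (balancing (Suc k)) ^ 3" by linarith
    then have "1 / real_of_int (balancing (Suc k)) ^ 3 \<le> 1 / 5 ^ k"
      by (intro frac_le) auto
    then show ?thesis using one by (simp add: power_one_over)
  qed
  then have "summable (\<lambda>k. ?f (k + 1))"
    by (intro summable_comparison_test[OF _ summable_geometric[of "1 / 5 :: real"]]) auto
  then have "summable ?f" by (rule summable_iff_shift[THEN iffD1])
  then have "summable (\<lambda>k. ?f (k + n))" by (rule summable_iff_shift[THEN iffD2])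
  then show ?thesis by (simp add: add.commute)
qed

end

theory Submission
  imports Defs
begin

text \<open>
  Since \<open>C\<^sub>m = B\<^bsub>m+1\<^esub> - 3 B\<^sub>m\<close>, the argument of the ceiling is \<open>3 (B\<^sub>n - B\<^bsub>n-1\<^esub>) / 164\<close>, so the
  right-hand side is \<open>\<lfloor>F\<rfloor>\<close> for \<open>F = B\<^sub>n\<^sup>3 - B\<^bsub>n-1\<^esub>\<^sup>3 - 3 (B\<^sub>n - B\<^bsub>n-1\<^esub>) / 164\<close>.  This \<open>F\<close> is a rational
  number with denominator 164, so it lies at least \<open>1/164\<close> below the integer \<open>\<lfloor>F\<rfloor> + 1\<close>, and it
  suffices to show \<open>F \<le> 1/S \<le> F + 1/200\<close> for the sum \<open>S\<close> of the series.

  Both bounds come from telescoping.  Let \<open>a, b, c\<close> be consecutive balancing numbers and let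
  \<open>F\<close>, \<open>F'\<close> belong to the pairs \<open>(a, b)\<close> and \<open>(b, c)\<close>.  Then \<open>1/b\<^sup>3 \<le> 1/F - 1/F'\<close> says
  \<open>F F' - b\<^sup>3 (F' - F) \<le> 0\<close>.  Because \<open>a + c = 6 b\<close> and \<open>a c = b\<^sup>2 - 1\<close>, the left-hand side is a
  polynomial in \<open>b\<close> alone.  With a coefficient \<open>t\<close> in place of \<open>3/164\<close> its terms of degree 6
  cancel and its term of degree 4 is \<open>(3 - 164 t) b\<^sup>4\<close>, which explains the constant \<open>3/164\<close>: what
  is left is about \<open>-3.9 b\<^sup>2\<close>, hence negative.  Replacing \<open>F\<close> by \<open>F + 1/200\<close> throughout adds about
  \<open>(F + F') / 200\<close>, roughly \<open>0.99 b\<^sup>3\<close>, which outweighs \<open>3.9 b\<^sup>2\<close> as soon as \<open>b \<ge> 6\<close>,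
  that is, from index 2 on.
\<close>

lemma suminf_le_telescope:
  fixes f h :: "nat \<Rightarrow> real"
  assumes "summable f" "h \<longlonglongrightarrow> 0" "\<And>k. f k \<le> h k - h (Suc k)"
  shows "suminf f \<le> h 0"
proof -
  have "(\<lambda>k. h k - h (Suc k)) sums (h 0 - 0)"
    by (rule telescope_sums'[OF assms(2)])
  then show ?thesis
    using sums_le[OF assms(3) summable_sums[OF assms(1)]] by simp
qed

lemma telescope_le_suminf:
  fixes f h :: "nat \<Rightarrow> real"
  assumes "summable f" "h \<longlonglongrightarrow> 0" "\<And>k. h k - h (Suc k) \<le> f k"
  shows "h 0 \<le> suminf f"
proof -
  have "(\<lambda>k. h k - h (Suc k)) sums (h 0 - 0)"
    by (rule telescope_sums'[OF assms(2)])
  then show ?thesis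
    using sums_le[OF assms(3) _ summable_sums[OF assms(1)]] by simp
qed

definition cube_gap :: "real \<Rightarrow> real \<Rightarrow> real" where
  "cube_gap a b = b ^ 3 - a ^ 3 - 3 / 164 * (b - a)"

text \<open>
  The defect in the telescoping identity.  The constants are what remains of
  \<open>-3 b\<^sup>2 + 1 - t (50 b\<^sup>2 + 2) + t\<^sup>2 (4 b\<^sup>2 + 1)\<close> at \<open>t = 3/164\<close>.
\<close>

lemma cube_gap_defect:
  fixes a b :: real
  assumes "a\<^sup>2 - 6 * a * b + b\<^sup>2 = 1"
  shows "cube_gap a b * cube_gap b (6 * b - a)
      - b ^ 3 * (cube_gap b (6 * b - a) - cube_gap a b)
    = (25921 - 105252 * b\<^sup>2) / 26896"
  using assms unfolding cube_gap_def by algebra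

lemma cube_gap_add:
  fixes a b :: real
  assumes "a\<^sup>2 - 6 * a * b + b\<^sup>2 = 1"
  shows "cube_gap a b + cube_gap b (6 * b - a) = (6 * b - 2 * a) * (35 * b\<^sup>2 + 161 / 164)"
  using assms unfolding cube_gap_def by algebra

lemma cube_gap_ge:
  fixes a b :: real
  assumes "0 \<le> a" "5 * a \<le> b" "1 \<le> b"
  shows "b / 2 \<le> cube_gap a b"
proof -
  have "a ^ 3 \<le> (b / 5) ^ 3"
    using assms by (intro power_mono) auto
  then have "a ^ 3 \<le> b ^ 3 / 125"
    by (simp add: power_divide)
  moreover have "b \<le> b ^ 3"
    using assms by (intro self_le_power) auto
  moreover have "3 / 164 * (b - a) \<le> 3 / 164 * b"
    using assms by simp
  ultimately show ?thesis
    using assms unfolding cube_gap_def by linarith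
qed

lemma inverse_cube_le_cube_gap_diff:
  fixes a b :: real
  assumes "a\<^sup>2 - 6 * a * b + b\<^sup>2 = 1" "0 \<le> a" "5 * a \<le> b" "1 \<le> b"
  shows "1 / b ^ 3 \<le> 1 / cube_gap a b - 1 / cube_gap b (6 * b - a)"
proof -
  define F G where "F = cube_gap a b" and "G = cube_gap b (6 * b - a)"
  have pos: "F > 0" "G > 0" "b ^ 3 > 0"
    using cube_gap_ge[of a b] cube_gap_ge[of b "6 * b - a"] assms by (auto simp: F_def G_def)
  have "1 \<le> b\<^sup>2"
    using assms by simp
  then have "F * G \<le> b ^ 3 * (G - F)"
    using cube_gap_defect[OF assms(1)] by (simp add: F_def G_def)
  then have "1 / b ^ 3 \<le> (G - F) / (F * G)"
    using pos by (simp add: field_simps)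
  also have "\<dots> = 1 / F - 1 / G"
    using pos by (simp add: field_simps)
  finally show ?thesis
    by (simp add: F_def G_def)
qed

lemma shifted_cube_gap_diff_le_inverse_cube:
  fixes a b :: real
  assumes "a\<^sup>2 - 6 * a * b + b\<^sup>2 = 1" "0 \<le> a" "5 * a \<le> b" "6 \<le> b"
  shows "1 / (cube_gap a b + 1 / 200) - 1 / (cube_gap b (6 * b - a) + 1 / 200) \<le> 1 / b ^ 3"
proof -
  define F G where "F = cube_gap a b" and "G = cube_gap b (6 * b - a)"
  define F' G' where "F' = F + 1 / 200" and "G' = G + 1 / 200"
  have pos: "F' > 0" "G' > 0" "b ^ 3 > 0"
    using cube_gap_ge[of a b] cube_gap_ge[of b "6 * b - a"] assms
    by (auto simp: F_def G_def F'_def G'_def)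
  \<comment> \<open>one factor \<open>b\<close> is at least \<open>6\<close>, and \<open>6 b - 2 a \<ge> 28/5 b\<close>\<close>
  have "1176 * b\<^sup>2 = 28 / 5 * 6 * (35 * b\<^sup>2)"
    by simp
  also have "\<dots> \<le> (6 * b - 2 * a) * (35 * b\<^sup>2 + 161 / 164)"
    using assms by (intro mult_mono) auto
  also have "\<dots> = F + G"
    using cube_gap_add[OF assms(1)] by (simp add: F_def G_def)
  finally have sum: "1176 * b\<^sup>2 \<le> F + G" .
  have "b ^ 3 * (G' - F') = F * G - (25921 - 105252 * b\<^sup>2) / 26896"
    using cube_gap_defect[OF assms(1), folded F_def G_def]
    unfolding F'_def G'_def add_diff_cancel_right by linarith
  also have "\<dots> \<le> F * G + (F + G) / 200 + 1 / 40000"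
  proof -
    have "105252 * b\<^sup>2 / 26896 \<le> 1176 * b\<^sup>2 / 200"
      by simp
    also have "\<dots> \<le> (F + G) / 200"
      using sum by (intro divide_right_mono) auto
    finally have "105252 * b\<^sup>2 / 26896 + - 25921 / 26896 \<le> (F + G) / 200 + 1 / 40000"
      by (rule add_mono) simp
    then show ?thesis
      unfolding diff_divide_distrib by simp
  qed
  also have "\<dots> = F' * G'"
    by (simp add: F'_def G'_def field_simps)
  finally have "(G' - F') / (F' * G') \<le> 1 / b ^ 3"
    using pos by (simp add: field_simps)
  moreover have "(G' - F') / (F' * G') = 1 / F' - 1 / G'"
    using pos by (simp add: field_simps)
  ultimately show ?thesis
    by (simp add: F_def G_def F'_def G'_def)
qed

abbreviation balancing_gap :: "nat \<Rightarrow> real" where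
  "balancing_gap m \<equiv> cube_gap (real_of_int (balancing m)) (real_of_int (balancing (Suc m)))"

lemma balancing_gap_ge: "5 ^ m / 2 \<le> balancing_gap m"
proof -
  have "real_of_int (5 ^ m) \<le> real_of_int (balancing (Suc m))"
    by (simp only: of_int_le_iff balancing_ge_power)
  then have *: "5 ^ m \<le> real_of_int (balancing (Suc m))"
    by simp
  moreover have "1 \<le> (5 :: real) ^ m"
    by simp
  moreover have "0 \<le> balancing m" "5 * balancing m \<le> balancing (Suc m)"
    using balancing_growth[of m] by auto
  ultimately show ?thesis
    using cube_gap_ge[of "balancing m" "balancing (Suc m)"] by linarith
qed

lemma inverse_shifted_balancing_gap_tendsto_0:
  assumes "0 \<le> e"
  shows "(\<lambda>k. 1 / (balancing_gap (m + k) + e)) \<longlonglongrightarrow> 0"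
proof (rule tendsto_sandwich[of "\<lambda>_. 0" _ _ "\<lambda>k. 2 * (1 / 5) ^ k"])
  have bound: "5 ^ k / 2 \<le> balancing_gap (m + k) + e" for k
  proof -
    have "(5 :: real) ^ k \<le> 5 ^ (m + k)"
      by (intro power_increasing) auto
    then show ?thesis
      using balancing_gap_ge[of "m + k"] assms by linarith
  qed
  have pos: "0 < (5 :: real) ^ k / 2" for k
    by simp
  show "\<forall>\<^sub>F k in sequentially. 0 \<le> 1 / (balancing_gap (m + k) + e)"
    using order.trans[OF less_imp_le[OF pos] bound] by simp
  have "1 / (balancing_gap (m + k) + e) \<le> 2 * (1 / 5) ^ k" for k
    using divide_left_mono[OF bound[of k], of 1] less_le_trans[OF pos bound, of k]
    by (simp add: power_one_over)
  then show "\<forall>\<^sub>F k in sequentially. 1 / (balancing_gap (m + k) + e) \<le> 2 * (1 / 5) ^ k"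
    by simp
  show "(\<lambda>k. 2 * (1 / 5) ^ k :: real) \<longlonglongrightarrow> 0"
    by (intro tendsto_mult_right_zero LIMSEQ_power_zero) simp
qed simp

lemma inverse_suminf_balancing_bounds:
  assumes "1 \<le> m"
  defines "S \<equiv> \<Sum>k. 1 / real_of_int (balancing (Suc m + k)) ^ 3"
  shows "balancing_gap m \<le> inverse S" "inverse S \<le> balancing_gap m + 1 / 200"
proof -
  let ?a = "\<lambda>k. real_of_int (balancing (m + k))"
  let ?b = "\<lambda>k. real_of_int (balancing (Suc m + k))"
  have cassini: "(?a k)\<^sup>2 - 6 * ?a k * ?b k + (?b k)\<^sup>2 = 1" for k
  proof -
    have "balancing (m + k) ^ 2 - 6 * balancing (m + k) * balancing (Suc m + k)
        + balancing (Suc m + k) ^ 2 = 1"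
      using balancing_Cassini[of "m + k"] by (simp add: algebra_simps)
    then have "real_of_int (balancing (m + k) ^ 2 - 6 * balancing (m + k) * balancing (Suc m + k)
        + balancing (Suc m + k) ^ 2) = real_of_int 1"
      by (rule arg_cong)
    then show ?thesis
      by simp
  qed
  have growth: "0 \<le> ?a k" "5 * ?a k \<le> ?b k" for k
    using balancing_growth[of "m + k"] by auto
  have large: "6 \<le> ?b k" for k
  proof -
    obtain j where j: "m + k = Suc j"
      using assms(1) by (cases "m + k") auto
    have "1 \<le> balancing (Suc j)"
      using balancing_ge_power[of j] one_le_power[of "5 :: int" j] by linarith
    \<comment> \<open>then \<open>6 B\<^bsub>j+1\<^esub> - B\<^sub>j \<ge> 29/5\<close>, and integrality rounds this up to 6\<close>
    moreover have "5 * balancing j \<le> balancing (Suc j)"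
      using balancing_growth[of j] by simp
    ultimately have "6 \<le> balancing (Suc (Suc j))"
      by simp
    then show ?thesis
      using j by simp
  qed
  have next_gap: "balancing_gap (m + Suc k) = cube_gap (?b k) (6 * ?b k - ?a k)" for k
    by simp
  have summ: "summable (\<lambda>k. 1 / ?b k ^ 3)"
    by (rule summable_inverse_balancing_cube)
  have "1 / ?b k ^ 3 \<le> 1 / (balancing_gap (m + k) + 0) - 1 / (balancing_gap (m + Suc k) + 0)" for k
    unfolding next_gap
    using inverse_cube_le_cube_gap_diff[OF cassini growth, of k] large[of k] by simp
  from suminf_le_telescope[OF summ inverse_shifted_balancing_gap_tendsto_0 this]
  have upper: "S \<le> 1 / balancing_gap m"
    by (simp add: S_def)
  have "1 / (balancing_gap (m + k) + 1 / 200) - 1 / (balancing_gap (m + Suc k) + 1 / 200)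
      \<le> 1 / ?b k ^ 3" for k
    unfolding next_gap
    using shifted_cube_gap_diff_le_inverse_cube[OF cassini growth large, of k] by simp
  from telescope_le_suminf[OF summ inverse_shifted_balancing_gap_tendsto_0 this]
  have lower: "1 / (balancing_gap m + 1 / 200) \<le> S"
    by (simp add: S_def)
  have "0 < balancing_gap m"
    using balancing_gap_ge[of m] zero_less_power[of "5 :: real" m] by linarith
  then have "0 < 1 / (balancing_gap m + 1 / 200)"
    by simp
  with lower have "0 < S"
    by linarith
  with upper lower \<open>0 < balancing_gap m\<close>
  show "balancing_gap m \<le> inverse S" "inverse S \<le> balancing_gap m + 1 / 200"
    by (auto simp: field_simps)
qed

text \<open>
  A fraction with denominator \<open>q\<close> is at least \<open>1 / q\<close> below the next integer, so a perturbation
  smaller than that does not change its floor.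
\<close>

lemma floor_eq_floor_fraction:
  fixes x :: real and N q :: int
  assumes "0 < q" "of_int N / of_int q \<le> x" "x < (of_int N + 1) / of_int q"
  shows "\<lfloor>x\<rfloor> = \<lfloor>of_int N / of_int q :: real\<rfloor>"
proof -
  have "N div q * q \<le> N" "N + 1 \<le> (N div q + 1) * q"
    using pos_mod_sign[OF assms(1), of N] pos_mod_bound[OF assms(1), of N] div_mult_mod_eq[of N q]
    unfolding distrib_right by linarith+
  then have "real_of_int (N div q * q) \<le> of_int N"
    "real_of_int (N + 1) \<le> real_of_int ((N div q + 1) * q)"
    by (simp_all only: of_int_le_iff)
  then have "of_int (N div q) \<le> (of_int N / of_int q :: real)"
    "(of_int N + 1) / of_int q \<le> (of_int (N div q) + 1 :: real)"
    using assms(1) by (simp_all add: pos_le_divide_eq pos_divide_le_eq)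
  then have "\<lfloor>x\<rfloor> = N div q"
    using assms by (intro floor_unique) linarith+
  then show ?thesis
    by (simp add: floor_divide_of_int_eq)
qed

theorem theorem1p1:
  fixes n :: nat
  assumes "n \<ge> 2"
  shows "\<lfloor>inverse (\<Sum>k. 1 / real_of_int (balancing (n + k)) ^ 3)\<rfloor>
    = balancing n ^ 3 - balancing (n - 1) ^ 3
      - \<lceil>3 * (2 * real_of_int (balancing (n - 1)) + lucas_balancing (n - 1)) / 164\<rceil>"
proof -
  obtain m where n: "n = Suc m" and m: "1 \<le> m"
    using assms by (cases n) auto
  define a b where "a = balancing m" and "b = balancing (Suc m)"
  define S where "S = (\<Sum>k. 1 / real_of_int (balancing (Suc m + k)) ^ 3)"
  define N where "N = 164 * (b ^ 3 - a ^ 3) - 3 * (b - a)"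
  have gap: "balancing_gap m = of_int N / of_int 164"
    by (simp add: N_def cube_gap_def a_def b_def field_simps)
  have "\<lfloor>inverse S\<rfloor> = \<lfloor>of_int N / of_int 164 :: real\<rfloor>"
    using inverse_suminf_balancing_bounds[OF m, folded S_def] unfolding gap
    by (intro floor_eq_floor_fraction) auto
  also have "of_int N / of_int 164 = real_of_int (b ^ 3 - a ^ 3) + - (3 * (b - a) / 164)"
    by (simp add: N_def field_simps)
  also have "\<lfloor>\<dots>\<rfloor> = b ^ 3 - a ^ 3 - \<lceil>3 * real_of_int (b - a) / 164\<rceil>"
    by (simp only: int_add_floor[symmetric] ceiling_def) simp
  also have "3 * real_of_int (b - a) / 164 = 3 * (2 * real_of_int a + lucas_balancing m) / 164"
    by (simp add: lucas_balancing_eq a_def b_def)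
  finally show ?thesis
    by (simp add: n S_def a_def b_def)
qed

end
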